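(* For each step size $s>0$, let $\{\mathbf{u}^n\}_{n=0}^\infty\subset U$ be a sequence (which may depend on $s$), with a given initial velocity $d_t\mathbf{u}^0\in U$ and $B(\mathbf{u}^0,\mathbf{u}^0)=\mathbf{u}_c$, such that $$B\Big(\tfrac{3\mathbf{u}^n-4\mathbf{u}^{n-1}+\mathbf{u}^{n-2}}{2s},\,2\mathbf{u}^{n-1}-\mathbf{u}^{n-2}\Big)=0\quad\text{for all } n\ge2,\qquad B\Big(\tfrac{\mathbf{u}^1-\mathbf{u}^0}{s},\mathbf{u}^0\Big)=0 .$$ Then there is a constant $C>0$ independent of $s$ and $N$ such that for all $N\ge1$, $$\|B(\mathbf{u}^N,\mathbf{u}^N)-\mathbf{u}_c\|_Z\le C\Big(s^2\|d_t\mathbf{u}^0\|_U^2+s^4\sum_{n=1}^N\|d_t^2\mathbf{u}^n\|_U^2\Big).$$ If in addition $d_t\mathbf{u}^0=\mathbf{0}$ and there is a constant $c_r>0$ such that for all $N>0$ and $s>0$ $$s\sum_{n=1}^N\|d_t^2\mathbf{u}^n\|_U^2\le c_r,$$ then there is a constant $C'>0$ independent of $s$ and $N$ such that $\|B(\mathbf{u}^N,\mathbf{u}^N)-\mathbf{u}_c\|_Z\le C's^3$.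
   Context: $U$ is a real Hilbert space, $Z$ is a normed function space, $B:U\times U\to Z$ is a symmetric bilinear operator with $\|B(\mathbf{v},\mathbf{v})\|_Z\le c_Z\|\mathbf{v}\|_U^2$ for all $\mathbf{v}\in U$, and $\mathbf{u}_c\in Z$ is given. Backward differences: $d_t\mathbf{u}^n=(\mathbf{u}^n-\mathbf{u}^{n-1})/s$ for $n\ge1$, $d_t\mathbf{u}^0$ is the prescribed initial velocity (equivalently $\mathbf{u}^{-1}:=\mathbf{u}^0-s\,d_t\mathbf{u}^0$), and $d_t^2\mathbf{u}^n=(d_t\mathbf{u}^n-d_t\mathbf{u}^{n-1})/s$ for $n\ge1$. *)

theory Defs
  imports "HOL-Analysis.Analysis"
begin

text \<open>Backward differences with step size \<open>s\<close>; \<open>v0\<close> is the prescribed initial velocity, so no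
  fictitious value at index \<open>-1\<close> is needed. The second difference is meant for \<open>n \<ge> 1\<close> only.\<close>

definition dt :: "real \<Rightarrow> 'u \<Rightarrow> (nat \<Rightarrow> 'u) \<Rightarrow> nat \<Rightarrow> 'u::real_vector" where
  "dt s v0 u n = (if n = 0 then v0 else (u n - u (n - 1)) /\<^sub>R s)"

definition dt2 :: "real \<Rightarrow> 'u \<Rightarrow> (nat \<Rightarrow> 'u) \<Rightarrow> nat \<Rightarrow> 'u::real_vector" where
  "dt2 s v0 u n = (dt s v0 u n - dt s v0 u (n - 1)) /\<^sub>R s"

end

theory Submission
  imports Defs
begin

text \<open>Write \<open>q v = B v v\<close>. The scheme is an exact balance law: testing the BDF2 difference against
  the extrapolated value gives \<open>(3 q\<^sub>n - q\<^sub>n\<^sub>-\<^sub>1) - (3 q\<^sub>n\<^sub>-\<^sub>1 - q\<^sub>n\<^sub>-\<^sub>2) = 3 q(u\<^sub>n - 2 u\<^sub>n\<^sub>-\<^sub>1 + u\<^sub>n\<^sub>-\<^sub>2)\<close>, and the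
  last argument is \<open>s\<^sup>2\<close> times the second difference. Summation bounds \<open>3 q\<^sub>n - q\<^sub>n\<^sub>-\<^sub>1\<close>, and the
  factor \<open>3\<close> against \<open>1\<close> makes the resulting one-step recursion for \<open>q\<^sub>n\<close> contractive.\<close>

text \<open>Here \<open>a\<close>, \<open>b\<close>, \<open>c\<close> stand for three consecutive
  iterates, newest first. By symmetry both sides are combinations of the same six products, so only
  their coefficients need comparing.\<close>

lemma bdf2_extrapolation_identity:
  fixes B :: "'u::real_vector \<Rightarrow> 'u \<Rightarrow> 'z::real_vector"
  assumes bilin: "bilinear B" and sym: "\<And>v w. B v w = B w v"
  shows "2 *\<^sub>R B (3 *\<^sub>R a - 4 *\<^sub>R b + c) (2 *\<^sub>R b - c)
    = (3 *\<^sub>R B a a - B b b) - (3 *\<^sub>R B b b - B c c) - 3 *\<^sub>R B (a - 2 *\<^sub>R b + c) (a - 2 *\<^sub>R b + c)"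
proof -
  note bl = bilinear_ladd[OF bilin] bilinear_radd[OF bilin] bilinear_lsub[OF bilin]
    bilinear_rsub[OF bilin] bilinear_lmul[OF bilin] bilinear_rmul[OF bilin]
  \<comment> \<open>Unfolding numeral coefficients into repeated sums reduces the identity to
    cancellation in an abelian group.\<close>
  have unary: "numeral (Num.Bit0 k) *\<^sub>R z = numeral k *\<^sub>R z + numeral k *\<^sub>R z"
    "numeral (Num.Bit1 k) *\<^sub>R z = numeral k *\<^sub>R z + numeral k *\<^sub>R z + z" for k and z :: 'z
    by (simp_all only: numeral_Bit0 numeral_Bit1 scaleR_left_distrib scaleR_one)
  have "B b a = B a b" "B c a = B a c" "B c b = B b c"
    by (rule sym)+
  then have "2 *\<^sub>R B (3 *\<^sub>R a - 4 *\<^sub>R b + c) (2 *\<^sub>R b - c)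
    - ((3 *\<^sub>R B a a - B b b) - (3 *\<^sub>R B b b - B c c) - 3 *\<^sub>R B (a - 2 *\<^sub>R b + c) (a - 2 *\<^sub>R b + c)) = 0"
    by (simp add: bl scaleR_right_distrib scaleR_right_diff_distrib) (simp add: unary algebra_simps)
  then show ?thesis by simp
qed

text \<open>Serves the first step, where \<open>u 1 - u 0\<close> splits into an initial velocity
  part and a second difference part. The factor 2 is that of
  \<open>(a + b)\<^sup>2 \<le> 2 * (a\<^sup>2 + b\<^sup>2)\<close>.\<close>

lemma quadratic_norm_add_le:
  fixes B :: "'u::real_inner \<Rightarrow> 'u \<Rightarrow> 'z::real_normed_vector"
  assumes bound: "\<And>v. norm (B v v) \<le> c * (norm v)\<^sup>2" and "c \<ge> 0"
  shows "norm (B (v + w) (v + w)) \<le> 2 * c * ((norm v)\<^sup>2 + (norm w)\<^sup>2)"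
proof -
  have "(norm (v + w))\<^sup>2 \<le> (norm v + norm w)\<^sup>2"
    by (intro power_mono norm_triangle_ineq) simp
  also have "\<dots> \<le> 2 * ((norm v)\<^sup>2 + (norm w)\<^sup>2)"
    using sum_squares_bound[of "norm v" "norm w"] by (simp add: power2_sum)
  finally have "c * (norm (v + w))\<^sup>2 \<le> c * (2 * ((norm v)\<^sup>2 + (norm w)\<^sup>2))"
    using \<open>c \<ge> 0\<close> by (rule mult_left_mono)
  with bound[of "v + w"] show ?thesis by (simp add: algebra_simps)
qed

text \<open>The step size is fixed here, but the factor \<open>3 * c\<close> depends on
  \<open>B\<close> alone, which gives uniformity in \<open>s\<close> and in the final index.\<close>

lemma bdf2_constraint_violation:
  fixes B :: "'u::real_inner \<Rightarrow> 'u \<Rightarrow> 'z::real_normed_vector" and u :: "nat \<Rightarrow> 'u"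
  assumes bilin: "bilinear B" and sym: "\<And>v w. B v w = B w v"
    and bound: "\<And>v. norm (B v v) \<le> c * (norm v)\<^sup>2" and c: "c \<ge> 0" and s: "s > 0"
    and scheme: "\<And>n. n \<ge> 2 \<Longrightarrow>
      B ((3 *\<^sub>R u n - 4 *\<^sub>R u (n - 1) + u (n - 2)) /\<^sub>R (2 * s)) (2 *\<^sub>R u (n - 1) - u (n - 2)) = 0"
    and first: "B ((u 1 - u 0) /\<^sub>R s) (u 0) = 0"
  shows "norm (B (u (Suc n)) (u (Suc n)) - B (u 0) (u 0)) \<le>
    3 * c * (s\<^sup>2 * (norm v)\<^sup>2 + s ^ 4 * (\<Sum>k=1..Suc n. (norm (dt2 s v u k))\<^sup>2))"
proof -
  \<comment> \<open>The sum runs to \<open>Suc n\<close>, so \<open>R n\<close> is the bound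
    matching \<open>x (Suc n)\<close>.\<close>
  define R where "R n = s\<^sup>2 * (norm v)\<^sup>2 + s ^ 4 * (\<Sum>k=1..Suc n. (norm (dt2 s v u k))\<^sup>2)" for n
  define x where "x n = B (u n) (u n) - B (u 0) (u 0)" for n
  have R_Suc: "R (Suc n) = R n + s ^ 4 * (norm (dt2 s v u (Suc (Suc n))))\<^sup>2" for n
    by (simp add: R_def algebra_simps)
  have R_mono: "R n \<le> R (Suc n)" for n
    by (simp add: R_Suc)
  \<comment> \<open>Passing from \<open>q\<close> to \<open>x\<close> shifts both differences by the
    same \<open>2 *\<^sub>R B (u 0) (u 0)\<close>, so the balance law persists.\<close>
  have increment: "3 *\<^sub>R x (Suc (Suc n)) - x (Suc n)
      = 3 *\<^sub>R x (Suc n) - x n + 3 *\<^sub>R B (s\<^sup>2 *\<^sub>R dt2 s v u (Suc (Suc n))) (s\<^sup>2 *\<^sub>R dt2 s v u (Suc (Suc n)))" for n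
  proof -
    have e: "s\<^sup>2 *\<^sub>R dt2 s v u (Suc (Suc n)) = u (Suc (Suc n)) - 2 *\<^sub>R u (Suc n) + u n"
      using s by (simp add: dt2_def dt_def power2_eq_square scaleR_2 algebra_simps)
    have "B (3 *\<^sub>R u (Suc (Suc n)) - 4 *\<^sub>R u (Suc n) + u n) (2 *\<^sub>R u (Suc n) - u n) = 0"
      using scheme[of "Suc (Suc n)"] s by (simp add: bilinear_lmul[OF bilin])
    with bdf2_extrapolation_identity[OF bilin sym, of "u (Suc (Suc n))" "u (Suc n)" "u n"]
    show ?thesis
      unfolding e x_def by (simp add: algebra_simps)
  qed
  have x1: "norm (x 1) \<le> 2 * c * R 0"
  proof -
    \<comment> \<open>Only the second difference at index 1 involves the prescribed velocity
      \<open>v\<close>.\<close>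
    have w: "u 1 - u 0 = s *\<^sub>R v + s\<^sup>2 *\<^sub>R dt2 s v u 1"
      using s by (simp add: dt2_def dt_def power2_eq_square algebra_simps)
    have "B (u 1 - u 0) (u 0) = 0"
      using first s by (simp add: bilinear_lmul[OF bilin])
    \<comment> \<open>The starting step gives \<open>B (u 1) (u 0) = B (u 0) (u 0)\<close>, so the
      mixed terms of the square leave exactly \<open>x 1\<close>.\<close>
    then have "x 1 = B (u 1 - u 0) (u 1 - u 0)"
      using sym[of "u 0" "u 1"]
      by (simp add: x_def bilinear_lsub[OF bilin] bilinear_rsub[OF bilin])
    then show ?thesis
      unfolding w using quadratic_norm_add_le[of B c "s *\<^sub>R v" "s\<^sup>2 *\<^sub>R dt2 s v u 1", OF bound c]
      by (simp add: R_def power_mult_distrib)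
  qed
  \<comment> \<open>The constant 6 comes from the start: \<open>x 0 = 0\<close> leaves
    \<open>3 *\<^sub>R x 1\<close>. Each later increment costs only \<open>3 * c\<close>, within the
    same constant.\<close>
  have flux: "norm (3 *\<^sub>R x (Suc n) - x n) \<le> 6 * c * R n" for n
  proof (induction n)
    case 0
    then show ?case using x1 by (simp add: x_def)
  next
    case (Suc n)
    let ?e = "s\<^sup>2 *\<^sub>R dt2 s v u (Suc (Suc n))"
    have "norm (3 *\<^sub>R x (Suc (Suc n)) - x (Suc n)) \<le> norm (3 *\<^sub>R x (Suc n) - x n) + norm (3 *\<^sub>R B ?e ?e)"
      unfolding increment by (rule norm_triangle_ineq)
    also have "\<dots> \<le> 6 * c * R n + 6 * (c * (norm ?e)\<^sup>2)"
      using Suc.IH bound[of ?e] norm_ge_zero[of "B ?e ?e"] unfolding norm_scaleR by linarith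
    also have "\<dots> = 6 * c * R (Suc n)"
      by (simp add: R_Suc power_mult_distrib algebra_simps)
    finally show ?case .
  qed
  \<comment> \<open>The factor \<open>K = 3 * c\<close> solves \<open>3 * K = 6 * c + K\<close>, so
    it reproduces itself in the recursion and does not grow with \<open>n\<close>.\<close>
  have "norm (x (Suc n)) \<le> 3 * c * R n"
  proof (induction n)
    case 0
    have "0 \<le> c * R 0" using c by (simp add: R_def)
    then show ?case using x1 by simp
  next
    case (Suc n)
    have "3 * norm (x (Suc (Suc n))) \<le> norm (3 *\<^sub>R x (Suc (Suc n)) - x (Suc n)) + norm (x (Suc n))"
      using norm_triangle_ineq[of "3 *\<^sub>R x (Suc (Suc n)) - x (Suc n)" "x (Suc n)"] by simp
    also have "\<dots> \<le> 6 * c * R (Suc n) + 3 * c * R n"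
      using flux Suc.IH by (rule add_mono)
    also have "\<dots> \<le> 9 * c * R (Suc n)"
      using mult_left_mono[OF R_mono c, of n] by simp
    finally show ?case by simp
  qed
  then show ?thesis by (simp add: x_def R_def)
qed

theorem corollary3p5:
  fixes B :: "'u::{real_inner,complete_space} \<Rightarrow> 'u \<Rightarrow> 'z::real_normed_vector"
    and c_Z :: real
    and u_c :: 'z
    and u :: "real \<Rightarrow> nat \<Rightarrow> 'u"
    and v0 :: "real \<Rightarrow> 'u"
  assumes bilin: "bilinear B"
    and sym: "\<And>v w. B v w = B w v"
    and bound: "\<And>v. norm (B v v) \<le> c_Z * (norm v)\<^sup>2"
    and init: "\<And>s. s > 0 \<Longrightarrow> B (u s 0) (u s 0) = u_c"
    and scheme: "\<And>s n. s > 0 \<Longrightarrow> n \<ge> 2 \<Longrightarrow>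
      B ((3 *\<^sub>R u s n - 4 *\<^sub>R u s (n - 1) + u s (n - 2)) /\<^sub>R (2 * s))
        (2 *\<^sub>R u s (n - 1) - u s (n - 2)) = 0"
    and first: "\<And>s. s > 0 \<Longrightarrow> B ((u s 1 - u s 0) /\<^sub>R s) (u s 0) = 0"
  shows "(\<exists>C>0. \<forall>s>0. \<forall>N\<ge>1.
        norm (B (u s N) (u s N) - u_c) \<le>
          C * (s\<^sup>2 * (norm (dt s (v0 s) (u s) 0))\<^sup>2
               + s ^ 4 * (\<Sum>n=1..N. (norm (dt2 s (v0 s) (u s) n))\<^sup>2)))
    \<and> ((\<forall>s>0. dt s (v0 s) (u s) 0 = 0) \<and>
       (\<exists>c_r>0. \<forall>N>0. \<forall>s>0. s * (\<Sum>n=1..N. (norm (dt2 s (v0 s) (u s) n))\<^sup>2) \<le> c_r)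
       \<longrightarrow> (\<exists>C'>0. \<forall>s>0. \<forall>N\<ge>1. norm (B (u s N) (u s N) - u_c) \<le> C' * s ^ 3))"
proof (intro conjI impI)
  \<comment> \<open>\<open>c_Z\<close> has no sign hypothesis; \<open>\<bar>c_Z\<bar> + 1\<close>
    dominates it and makes \<open>C\<close> positive.\<close>
  define C where "C = 3 * (\<bar>c_Z\<bar> + 1)"
  have "C > 0" by (simp add: C_def)
  have bound': "norm (B v v) \<le> (\<bar>c_Z\<bar> + 1) * (norm v)\<^sup>2" for v
    by (rule order_trans[OF bound]) (intro mult_right_mono, auto)
  have main: "norm (B (u s N) (u s N) - u_c) \<le>
      C * (s\<^sup>2 * (norm (dt s (v0 s) (u s) 0))\<^sup>2 + s ^ 4 * (\<Sum>n=1..N. (norm (dt2 s (v0 s) (u s) n))\<^sup>2))"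
    if "s > 0" "N \<ge> 1" for s N
  proof -
    obtain n where "N = Suc n"
      using \<open>N \<ge> 1\<close> by (cases N) auto
    then show ?thesis
      using bdf2_constraint_violation[of B "\<bar>c_Z\<bar> + 1" s "u s" n "v0 s",
          OF bilin sym bound' _ \<open>s > 0\<close> scheme[OF \<open>s > 0\<close>] first[OF \<open>s > 0\<close>]] init[OF \<open>s > 0\<close>]
      by (simp add: C_def dt_def)
  qed
  show "\<exists>C>0. \<forall>s>0. \<forall>N\<ge>1. norm (B (u s N) (u s N) - u_c) \<le>
      C * (s\<^sup>2 * (norm (dt s (v0 s) (u s) 0))\<^sup>2 + s ^ 4 * (\<Sum>n=1..N. (norm (dt2 s (v0 s) (u s) n))\<^sup>2))"
    using main \<open>C > 0\<close> by blast
  assume "(\<forall>s>0. dt s (v0 s) (u s) 0 = 0) \<and>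
    (\<exists>c_r>0. \<forall>N>0. \<forall>s>0. s * (\<Sum>n=1..N. (norm (dt2 s (v0 s) (u s) n))\<^sup>2) \<le> c_r)"
  then obtain c_r where rest: "\<And>s. s > 0 \<Longrightarrow> dt s (v0 s) (u s) 0 = 0" and "c_r > 0"
    and c_r: "\<And>N s. N > 0 \<Longrightarrow> s > 0 \<Longrightarrow> s * (\<Sum>n=1..N. (norm (dt2 s (v0 s) (u s) n))\<^sup>2) \<le> c_r"
    by blast
  \<comment> \<open>Zero initial velocity removes the \<open>s\<^sup>2\<close> term; one factor of
    \<open>s ^ 4\<close> is spent on the bound \<open>c_r\<close>, leaving
    \<open>s ^ 3\<close>.\<close>
  have "norm (B (u s N) (u s N) - u_c) \<le> C * c_r * s ^ 3" if "s > 0" "N \<ge> 1" for s N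
  proof -
    let ?S = "\<Sum>n=1..N. (norm (dt2 s (v0 s) (u s) n))\<^sup>2"
    have "norm (B (u s N) (u s N) - u_c) \<le> C * (s ^ 4 * ?S)"
      using main[OF that] rest[OF \<open>s > 0\<close>] by simp
    also have "\<dots> = C * s ^ 3 * (s * ?S)"
      by (simp add: eval_nat_numeral)
    also have "\<dots> \<le> C * s ^ 3 * c_r"
      using \<open>C > 0\<close> that c_r[of N s] by (intro mult_left_mono) auto
    finally show ?thesis by (simp add: mult_ac)
  qed
  then show "\<exists>C'>0. \<forall>s>0. \<forall>N\<ge>1. norm (B (u s N) (u s N) - u_c) \<le> C' * s ^ 3"
    using \<open>C > 0\<close> \<open>c_r > 0\<close> by (intro exI[of _ "C * c_r"]) simp
qed

end
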